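(* Let $1\le r\le n$. In the algebra of all polynomials on $M(n,\mathbb C)$, the ideal $I_r$ generated by all $r\times r$ minors is invariant under Hamiltonian flow for the standard Poisson structure; that is, $\{f,g\}_0\in I_r$ for every polynomial $f$ and every $g\in I_r$.
   Context: Let $Z_{i,j}$, $1\le i,j\le n$, be the coordinate functions on $M(n,\mathbb C)$. The standard Poisson bracket $\{\cdot,\cdot\}_0$ on polynomial functions is determined by bilinearity, antisymmetry, the Leibniz rule and $\{Z_{i,j},Z_{i,k}\}_0=Z_{i,j}Z_{i,k}$ if $j<k$; $\{Z_{i,j},Z_{k,j}\}_0=Z_{i,j}Z_{k,j}$ if $i<k$; $\{Z_{i,j},Z_{s,t}\}_0=0$ if $i<s$, $t<j$; $\{Z_{i,j},Z_{s,t}\}_0=2Z_{i,t}Z_{s,j}$ if $i<s$, $j<t$. *)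

theory Defs
  imports
    "HOL-Analysis.Derivative"
    "HOL-Algebra.Ideal"
    "Jordan_Normal_Form.Determinant"
begin

(* M(n,C) is complex^'n^'n, where 'n is a finite linearly ordered index type with CARD('n) = n. *)

type_synonym 'n cmat = "complex^'n^'n"

no_notation vec_index (infixl "$" 100)

inductive_set polyfun :: "('n::{finite,linorder} cmat \<Rightarrow> complex) set" where
  const: "(\<lambda>A. c) \<in> polyfun"
| coord: "(\<lambda>A. A $ i $ j) \<in> polyfun"
| add: "f \<in> polyfun \<Longrightarrow> g \<in> polyfun \<Longrightarrow> (\<lambda>A. f A + g A) \<in> polyfun"
| mult: "f \<in> polyfun \<Longrightarrow> g \<in> polyfun \<Longrightarrow> (\<lambda>A. f A * g A) \<in> polyfun"

definition Z :: "'n \<Rightarrow> 'n \<Rightarrow> 'n::{finite,linorder} cmat \<Rightarrow> complex" where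
  "Z i j = (\<lambda>A. A $ i $ j)"

definition polyfun_ring :: "('n::{finite,linorder} cmat \<Rightarrow> complex) ring" where
  "polyfun_ring = \<lparr>carrier = polyfun,
     mult = (\<lambda>f g A. f A * g A), one = (\<lambda>A. 1),
     zero = (\<lambda>A. 0), add = (\<lambda>f g A. f A + g A)\<rparr>"

(* Rows p 0 < ... < p (r-1) and columns q 0 < ... < q (r-1) are selected. *)
definition minor ::
  "nat \<Rightarrow> (nat \<Rightarrow> 'n) \<Rightarrow> (nat \<Rightarrow> 'n) \<Rightarrow> 'n::{finite,linorder} cmat \<Rightarrow> complex" where
  "minor r p q = (\<lambda>A. Determinant.det (Matrix.mat r r (\<lambda>(a, b). A $ p a $ q b)))"

definition minors :: "nat \<Rightarrow> ('n::{finite,linorder} cmat \<Rightarrow> complex) set" where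
  "minors r = {minor r p q | p q. strict_mono_on {..<r} p \<and> strict_mono_on {..<r} q}"

definition minor_ideal :: "nat \<Rightarrow> ('n::{finite,linorder} cmat \<Rightarrow> complex) set" where
  "minor_ideal r = genideal polyfun_ring (minors r)"

(* Only the values on polynomial functions are constrained. Linearity and the Leibniz rule in the
   second argument follow from antisymmetry. *)
locale standard_poisson_bracket =
  fixes B :: "('n::{finite,linorder} cmat \<Rightarrow> complex) \<Rightarrow> ('n cmat \<Rightarrow> complex)
    \<Rightarrow> 'n cmat \<Rightarrow> complex"
  assumes closed: "f \<in> polyfun \<Longrightarrow> g \<in> polyfun \<Longrightarrow> B f g \<in> polyfun"
    and add_left: "f \<in> polyfun \<Longrightarrow> g \<in> polyfun \<Longrightarrow> h \<in> polyfun
      \<Longrightarrow> B (\<lambda>A. f A + g A) h = (\<lambda>A. B f h A + B g h A)"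
    and scale_left: "f \<in> polyfun \<Longrightarrow> h \<in> polyfun
      \<Longrightarrow> B (\<lambda>A. c * f A) h = (\<lambda>A. c * B f h A)"
    and antisym: "f \<in> polyfun \<Longrightarrow> g \<in> polyfun \<Longrightarrow> B f g = (\<lambda>A. - B g f A)"
    and leibniz_left: "f \<in> polyfun \<Longrightarrow> g \<in> polyfun \<Longrightarrow> h \<in> polyfun
      \<Longrightarrow> B (\<lambda>A. f A * g A) h = (\<lambda>A. f A * B g h A + B f h A * g A)"
    and same_row: "j < k \<Longrightarrow> B (Z i j) (Z i k) = (\<lambda>A. Z i j A * Z i k A)"
    and same_column: "i < k \<Longrightarrow> B (Z i j) (Z k j) = (\<lambda>A. Z i j A * Z k j A)"
    and antidiagonal: "i < s \<Longrightarrow> t < j \<Longrightarrow> B (Z i j) (Z s t) = (\<lambda>A. 0)"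
    and diagonal: "i < s \<Longrightarrow> j < t \<Longrightarrow> B (Z i j) (Z s t) = (\<lambda>A. 2 * Z i t A * Z s j A)"

lemma polyfun_Z: "Z i j \<in> polyfun"
  by (simp add: Z_def polyfun.coord)

lemma polyfun_uminus: "f \<in> polyfun \<Longrightarrow> (\<lambda>A. - f A) \<in> polyfun"
  using polyfun.mult[OF polyfun.const[of "-1"], of f] by simp

lemma polyfun_sum:
  "finite S \<Longrightarrow> (\<And>x. x \<in> S \<Longrightarrow> f x \<in> polyfun) \<Longrightarrow> (\<lambda>A. \<Sum>x\<in>S. f x A) \<in> polyfun"
  by (induction S rule: finite_induct) (auto intro: polyfun.intros)

lemma polyfun_prod:
  "finite S \<Longrightarrow> (\<And>x. x \<in> S \<Longrightarrow> f x \<in> polyfun) \<Longrightarrow> (\<lambda>A. \<Prod>x\<in>S. f x A) \<in> polyfun"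
  by (induction S rule: finite_induct) (auto intro: polyfun.intros)

lemma minor_polyfun: "minor r p q \<in> polyfun"
proof -
  have "minor r p q = (\<lambda>A. \<Sum>\<pi> | \<pi> permutes {0..<r}. signof \<pi> * (\<Prod>i = 0..<r. A $ p i $ q (\<pi> i)))"
    by (auto simp: minor_def Determinant.det_def fun_eq_iff permutes_in_image
        intro!: sum.cong prod.cong)
  then show ?thesis
    by (auto intro!: polyfun_sum polyfun_prod polyfun.intros finite_permutations)
qed

lemma minors_polyfun: "minors r \<subseteq> polyfun"
  by (auto simp: minors_def minor_polyfun)

lemma cring_polyfun_ring: "cring polyfun_ring"
proof (rule cringI)
  show "abelian_group polyfun_ring"
  proof (rule abelian_groupI)
    fix f assume "f \<in> carrier (polyfun_ring :: ('n::{finite,linorder} cmat \<Rightarrow> complex) ring)"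
    then show "\<exists>g\<in>carrier polyfun_ring. g \<oplus>\<^bsub>polyfun_ring\<^esub> f = \<zero>\<^bsub>polyfun_ring\<^esub>"
      by (intro bexI[of _ "\<lambda>A. - f A"]) (auto simp: polyfun_ring_def polyfun_uminus)
  qed (auto simp: polyfun_ring_def algebra_simps intro: polyfun.intros)
  show "comm_monoid polyfun_ring"
    by (rule comm_monoidI) (auto simp: polyfun_ring_def algebra_simps intro: polyfun.intros)
qed (auto simp: polyfun_ring_def algebra_simps)

definition perturb :: "'n \<Rightarrow> 'n \<Rightarrow> 'n::{finite,linorder} cmat \<Rightarrow> complex \<Rightarrow> 'n cmat" where
  "perturb i j A z = (\<chi> a b. A $ a $ b + (if a = i \<and> b = j then z else 0))"

definition pd :: "'n \<Rightarrow> 'n \<Rightarrow> ('n::{finite,linorder} cmat \<Rightarrow> complex)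
    \<Rightarrow> 'n cmat \<Rightarrow> complex" where
  "pd i j f = (\<lambda>A. deriv (\<lambda>z. f (perturb i j A z)) 0)"

lemma perturb_0 [simp]: "perturb i j A 0 = A"
  by (simp add: perturb_def vec_eq_iff)

lemma pd_eqI:
  "(\<And>A. ((\<lambda>z. f (perturb i j A z)) has_field_derivative D A) (at 0)) \<Longrightarrow> pd i j f = D"
  by (auto simp: pd_def fun_eq_iff intro: DERIV_imp_deriv)

lemma coord_has_derivative:
  "((\<lambda>z. perturb i j A z $ s $ t) has_field_derivative (if s = i \<and> t = j then 1 else 0)) (at 0)"
  by (auto simp: perturb_def intro!: derivative_eq_intros)

lemma polyfun_has_derivative:
  assumes "f \<in> polyfun"
  shows "((\<lambda>z. f (perturb i j A z)) has_field_derivative pd i j f A) (at 0)"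
proof -
  have "\<exists>D. ((\<lambda>z. f (perturb i j A z)) has_field_derivative D) (at 0)"
    using assms
  proof induction
    case (coord s t) then show ?case using coord_has_derivative by blast
  qed (auto intro: DERIV_const DERIV_add DERIV_mult)
  then show ?thesis by (auto simp: pd_def DERIV_imp_deriv)
qed

lemma pd_const: "pd i j (\<lambda>A. c) = (\<lambda>A. 0)"
  by (rule pd_eqI) auto

lemma pd_coord: "pd i j (\<lambda>A. A $ s $ t) = (\<lambda>A. if s = i \<and> t = j then 1 else 0)"
  by (rule pd_eqI) (rule coord_has_derivative)

lemma pd_add: "f \<in> polyfun \<Longrightarrow> g \<in> polyfun \<Longrightarrow>
    pd i j (\<lambda>A. f A + g A) = (\<lambda>A. pd i j f A + pd i j g A)"
  by (intro pd_eqI DERIV_add polyfun_has_derivative)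

lemma pd_mult: "f \<in> polyfun \<Longrightarrow> g \<in> polyfun \<Longrightarrow>
    pd i j (\<lambda>A. f A * g A) = (\<lambda>A. pd i j f A * g A + pd i j g A * f A)"
  using DERIV_mult[OF polyfun_has_derivative polyfun_has_derivative, of f g i j _ i j]
  by (intro pd_eqI) auto

lemma pd_scale: "f \<in> polyfun \<Longrightarrow> pd i j (\<lambda>A. c * f A) = (\<lambda>A. c * pd i j f A)"
  using pd_mult[OF polyfun.const, of f i j c] by (simp add: pd_const mult.commute)

lemma pd_polyfun: "f \<in> polyfun \<Longrightarrow> pd i j f \<in> polyfun"
  by (induction rule: polyfun.induct)
    (auto simp: pd_const pd_coord pd_add pd_mult intro: polyfun.intros)

definition sg :: "'n::linorder \<Rightarrow> 'n \<Rightarrow> complex" where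
  "sg i s = (if i < s then 1 else if s < i then -1 else 0)"

lemma sg_swap: "sg i s = - sg s i"
  by (auto simp: sg_def)

(* {f,g} is the sum of the products of partial derivatives with {Z i j, Z s t}; the four generator
   relations are uniformly {Z i j, Z s t} = (sg i s + sg j t) * Z i t * Z s j. *)
definition std_bracket :: "('n::{finite,linorder} cmat \<Rightarrow> complex)
    \<Rightarrow> ('n cmat \<Rightarrow> complex) \<Rightarrow> 'n cmat \<Rightarrow> complex" where
  "std_bracket f g = (\<lambda>A. \<Sum>((i, j), (s, t)) \<in> UNIV.
     pd i j f A * pd s t g A * ((sg i s + sg j t) * (A $ i $ t * A $ s $ j)))"

lemma std_bracket_Z:
  "std_bracket (Z i j) (Z s t) = (\<lambda>A. (sg i s + sg j t) * (A $ i $ t * A $ s $ j))"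
proof
  fix A
  have "std_bracket (Z i j) (Z s t) A = (\<Sum>x\<in>UNIV. if x = ((i, j), (s, t))
      then (sg i s + sg j t) * (A $ i $ t * A $ s $ j) else 0)"
    unfolding std_bracket_def Z_def pd_coord by (rule sum.cong) (auto split: if_splits)
  then show "std_bracket (Z i j) (Z s t) A = (sg i s + sg j t) * (A $ i $ t * A $ s $ j)"
    by simp
qed

theorem std_bracket_standard: "standard_poisson_bracket std_bracket"
proof
  fix f g h :: "'n::{finite,linorder} cmat \<Rightarrow> complex" and c
  assume f: "f \<in> polyfun" and h: "h \<in> polyfun"
  show "std_bracket (\<lambda>A. c * f A) h = (\<lambda>A. c * std_bracket f h A)"
    by (auto simp: std_bracket_def pd_scale[OF f] sum_distrib_left fun_eq_iff mult.assoc
        intro!: sum.cong)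
  assume g: "g \<in> polyfun"
  show "std_bracket (\<lambda>A. f A + g A) h = (\<lambda>A. std_bracket f h A + std_bracket g h A)"
    by (auto simp: std_bracket_def pd_add[OF f g] sum.distrib[symmetric] fun_eq_iff algebra_simps
        intro!: sum.cong)
  show "std_bracket (\<lambda>A. f A * g A) h = (\<lambda>A. f A * std_bracket g h A + std_bracket f h A * g A)"
    by (auto simp: std_bracket_def pd_mult[OF f g] sum.distrib[symmetric] sum_distrib_left
        sum_distrib_right fun_eq_iff algebra_simps intro!: sum.cong)
next
  fix f g :: "'n::{finite,linorder} cmat \<Rightarrow> complex"
  assume f: "f \<in> polyfun" and g: "g \<in> polyfun"
  have "(\<lambda>A. \<Sum>x\<in>UNIV. (case x of ((i, j), (s, t)) \<Rightarrow> \<lambda>A.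
      pd i j f A * pd s t g A * ((sg i s + sg j t) * (A $ i $ t * A $ s $ j))) A) \<in> polyfun"
    by (rule polyfun_sum) (auto intro!: polyfun.intros pd_polyfun f g)
  then show "std_bracket f g \<in> polyfun"
    by (simp add: std_bracket_def case_prod_unfold)
  show "std_bracket f g = (\<lambda>A. - std_bracket g f A)"
  proof
    fix A :: "'n cmat"
    let ?F = "\<lambda>f g ((i, j), (s, t)).
      pd i j f A * pd s t g A * ((sg i s + sg j t) * (A $ i $ t * A $ s $ j))"
    have swap: "?F g f (prod.swap x) = - ?F f g x" for x
    proof -
      obtain i j s t where x: "x = ((i, j), (s, t))" by (metis prod.exhaust)
      show ?thesis by (simp add: x sg_swap[of s i] sg_swap[of t j] algebra_simps)
    qed
    have "std_bracket g f A = (\<Sum>x\<in>UNIV. ?F g f (prod.swap x))"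
      unfolding std_bracket_def
      by (rule sum.reindex_bij_betw[symmetric]) (rule bij_swap)
    also have "\<dots> = - std_bracket f g A"
      unfolding swap sum_negf std_bracket_def ..
    finally show "std_bracket f g A = - std_bracket g f A" by simp
  qed
qed (simp_all add: std_bracket_Z, auto simp: Z_def sg_def fun_eq_iff)

theorem standard_poisson_bracket_unique:
  fixes B C :: "('n::{finite,linorder} cmat \<Rightarrow> complex) \<Rightarrow> ('n cmat \<Rightarrow> complex)
    \<Rightarrow> 'n cmat \<Rightarrow> complex"
  assumes "standard_poisson_bracket B" "standard_poisson_bracket C"
    and f: "f \<in> polyfun" and g: "g \<in> polyfun"
  shows "B f g = C f g"
proof -
  interpret B: standard_poisson_bracket B by fact
  interpret C: standard_poisson_bracket C by fact
  have E_const: "E (\<lambda>A. c) h = (\<lambda>A. 0)" if "standard_poisson_bracket E" "h \<in> polyfun"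
    for E :: "('n cmat \<Rightarrow> complex) \<Rightarrow> ('n cmat \<Rightarrow> complex) \<Rightarrow> 'n cmat \<Rightarrow> complex" and c h
  proof -
    interpret E: standard_poisson_bracket E by fact
    have "E (\<lambda>A. 1) h = (\<lambda>A. 0)"
      using E.leibniz_left[OF polyfun.const[of 1] polyfun.const[of 1] that(2)]
      by (auto simp: fun_eq_iff)
    then show ?thesis using E.scale_left[OF polyfun.const[of 1] that(2), of c] by simp
  qed
  have ext: "B f h = C f h"
    if gen: "\<And>i j. B (Z i j) h = C (Z i j) h" and f: "f \<in> polyfun" and h: "h \<in> polyfun" for f h
    using f
  proof induction
    case (const c) then show ?case by (simp add: E_const[OF assms(1) h] E_const[OF assms(2) h])
  next
    case (coord i j) then show ?case using gen by (simp add: Z_def)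
  qed (simp_all add: B.add_left C.add_left B.leibniz_left C.leibniz_left h)
  have ZZ: "B (Z i j) (Z s t) = C (Z i j) (Z s t)" for i j s t
  proof -
    have half: "B (Z i j) (Z s t) = C (Z i j) (Z s t)" if "i < s \<or> i = s \<and> j < t" for i j s t
      using that B.same_row C.same_row B.same_column C.same_column B.antidiagonal C.antidiagonal
        B.diagonal C.diagonal by (metis linorder_less_linear)
    have refl: "E (Z i j) (Z i j) = (\<lambda>A. 0)" if "standard_poisson_bracket E"
      for E :: "('n cmat \<Rightarrow> complex) \<Rightarrow> ('n cmat \<Rightarrow> complex) \<Rightarrow> 'n cmat \<Rightarrow> complex" and i j
      using standard_poisson_bracket.antisym[OF that polyfun_Z polyfun_Z, of i j i j]
      by (auto simp: fun_eq_iff)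
    show ?thesis
      using half[of i s j t] half[of s i t j] refl assms(1,2)
        B.antisym[OF polyfun_Z polyfun_Z, of i j s t] C.antisym[OF polyfun_Z polyfun_Z, of i j s t]
      by (metis linorder_less_linear)
  qed
  have "B (Z i j) g = C (Z i j) g" for i j
    using ext[OF ZZ g polyfun_Z, of i j] B.antisym[OF polyfun_Z g] C.antisym[OF polyfun_Z g]
    by simp
  then show ?thesis using ext f g by blast
qed

end

theory Submission imports Defs begin

text \<open>On coordinate functions the bracket is
  \<open>{Z s t, Z i j} = (sg s i + sg t j) * Z s j * Z i t\<close>, where \<open>sg\<close> is the sign of the order
  comparison. For a minor with rows \<open>p\<close> and columns \<open>q\<close>, the Leibniz rule expresses its bracket
  with \<open>Z i j\<close> as the sum of the brackets of its entries weighted by their cofactors. The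
  summand of the entry in row \<open>p a\<close> and column \<open>q b\<close> splits in two: in the \<open>sg (p a) i\<close> part
  the only factors depending on \<open>b\<close> are \<open>Z i (q b)\<close> and the cofactor, so summing over \<open>b\<close> is a
  Laplace expansion of the minor with row \<open>p a\<close> replaced by row \<open>i\<close>; symmetrically, the
  \<open>sg (q b) j\<close> part summed over \<open>a\<close> gives the minor with column \<open>q b\<close> replaced by column \<open>j\<close>
  (\<open>bracket_minor_Z\<close>). The new selections need not be increasing, but minors with arbitrary
  selections still lie in the ideal, being zero or a minor up to sign (\<open>minor_in_minor_ideal\<close>).

  So \<open>{_, Z i j}\<close> maps every generator into the ideal, and by the Leibniz rule the whole ideal
  into itself (\<open>bracket_Z_in_minor_ideal\<close>). Since the coordinates generate the algebra of
  polynomial functions, the Leibniz rule in the other argument passes from \<open>Z i j\<close> to an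
  arbitrary polynomial (\<open>minor_ideal_invariant\<close>).\<close>

section \<open>Ideals of polynomial functions\<close>

lemma polyfun_ring_simps [simp]:
  "carrier polyfun_ring = polyfun"
  "f \<otimes>\<^bsub>polyfun_ring\<^esub> g = (\<lambda>A. f A * g A)"
  "f \<oplus>\<^bsub>polyfun_ring\<^esub> g = (\<lambda>A. f A + g A)"
  "\<zero>\<^bsub>polyfun_ring\<^esub> = (\<lambda>A. 0)"
  by (simp_all add: polyfun_ring_def)

text \<open>Negatives come for free: they are multiples by the constant \<open>-1\<close>.\<close>

lemma ideal_polyfun_ringI:
  fixes J :: "('n::{finite,linorder} cmat \<Rightarrow> complex) set"
  assumes sub: "J \<subseteq> polyfun" and zero: "(\<lambda>A. 0) \<in> J"
    and add: "\<And>f g. f \<in> J \<Longrightarrow> g \<in> J \<Longrightarrow> (\<lambda>A. f A + g A) \<in> J"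
    and mult: "\<And>f g. f \<in> polyfun \<Longrightarrow> g \<in> J \<Longrightarrow> (\<lambda>A. f A * g A) \<in> J"
  shows "ideal J polyfun_ring"
proof -
  interpret R: cring "polyfun_ring :: ('n cmat \<Rightarrow> complex) ring"
    by (rule cring_polyfun_ring)
  have neg: "\<ominus>\<^bsub>polyfun_ring\<^esub> g = (\<lambda>A. - g A)" if "g \<in> polyfun"
    for g :: "'n cmat \<Rightarrow> complex"
    by (rule R.minus_equality) (use that in \<open>auto intro: polyfun_uminus\<close>)
  have "subgroup J (add_monoid polyfun_ring)"
  proof (rule R.add.subgroupI)
    fix g assume g: "g \<in> J"
    then have "(\<lambda>A. - 1 * g A) \<in> J" by (intro mult polyfun.const)
    then show "\<ominus>\<^bsub>polyfun_ring\<^esub> g \<in> J" using neg[of g] sub g by auto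
  qed (use sub zero add in auto)
  moreover have "(\<lambda>A. g A * f A) \<in> J" if "f \<in> polyfun" "g \<in> J" for f g
    using mult[OF that] by (simp add: mult.commute)
  ultimately show ?thesis
    by (intro idealI R.ring_axioms) (auto intro: mult)
qed

lemma ideal_minor_ideal: "ideal (minor_ideal r) polyfun_ring"
  unfolding minor_ideal_def
  by (rule ring.genideal_ideal) (simp_all add: cring.axioms(1) cring_polyfun_ring minors_polyfun)

lemma minor_ideal_polyfun: "f \<in> minor_ideal r \<Longrightarrow> f \<in> polyfun"
  using ideal.Icarr[OF ideal_minor_ideal] by auto

lemma minor_ideal_zero: "(\<lambda>A. 0) \<in> minor_ideal r"
  using additive_subgroup.zero_closed[OF ideal.axioms(1)[OF ideal_minor_ideal]] by simp

lemma minor_ideal_add: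
  "f \<in> minor_ideal r \<Longrightarrow> g \<in> minor_ideal r \<Longrightarrow> (\<lambda>A. f A + g A) \<in> minor_ideal r"
  using additive_subgroup.a_closed[OF ideal.axioms(1)[OF ideal_minor_ideal]] by fastforce

lemma minor_ideal_mult:
  "f \<in> polyfun \<Longrightarrow> g \<in> minor_ideal r \<Longrightarrow> (\<lambda>A. f A * g A) \<in> minor_ideal r"
  using ideal.I_l_closed[OF ideal_minor_ideal] by fastforce

lemma minor_ideal_sum:
  "finite S \<Longrightarrow> (\<And>x. x \<in> S \<Longrightarrow> f x \<in> minor_ideal r) \<Longrightarrow> (\<lambda>A. \<Sum>x\<in>S. f x A) \<in> minor_ideal r"
  by (induction S rule: finite_induct) (auto intro: minor_ideal_zero minor_ideal_add)

lemma minors_in_minor_ideal: "minors r \<subseteq> minor_ideal r"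
  by (auto simp: minor_ideal_def genideal_def)

section \<open>Minors with arbitrary row and column selections\<close>

lemma minor_transpose: "minor r p q A = minor r q p (\<chi> i j. A $ j $ i)"
proof -
  let ?M = "Matrix.mat r r (\<lambda>(a, b). A $ p a $ q b)"
  have "Matrix.mat r r (\<lambda>(a, b). A $ p b $ q a) = transpose_mat ?M" by auto
  then show ?thesis by (simp add: minor_def Determinant.det_transpose[of ?M r])
qed

lemma minor_not_inj_rows:
  fixes p q :: "nat \<Rightarrow> 'n::{finite,linorder}"
  assumes "\<not> inj_on p {..<r}"
  shows "minor r p q = (\<lambda>A. 0)"
proof
  fix A :: "'n cmat"
  obtain a b where "a < r" "b < r" "a \<noteq> b" "p a = p b"
    using assms by (auto simp: inj_on_def)
  then show "minor r p q A = 0"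
    unfolding minor_def by (intro det_identical_rows[of _ r a b]) auto
qed

lemma minor_not_inj_columns:
  assumes "\<not> inj_on q {..<r}"
  shows "minor r p q = (\<lambda>A. 0)"
  using minor_not_inj_rows[OF assms, of p] minor_transpose[of r p q] by auto

lemma minor_permute_rows:
  fixes p p' q :: "nat \<Rightarrow> 'n::{finite,linorder}"
  assumes "\<sigma> permutes {..<r}" and "\<And>a. a < r \<Longrightarrow> p a = p' (\<sigma> a)"
  shows "minor r p q = (\<lambda>A. signof \<sigma> * minor r p' q A)"
proof
  fix A :: "'n cmat"
  let ?M = "Matrix.mat r r (\<lambda>(a, b). A $ p' a $ q b)"
  have "a < r \<Longrightarrow> \<sigma> a < r" for a using permutes_in_image[OF assms(1), of a] by simp
  then have "Matrix.mat r r (\<lambda>(a, b). A $ p a $ q b) = Matrix.mat r r (\<lambda>(a, b). ?M $$ (\<sigma> a, b))"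
    by (auto simp: assms(2))
  then show "minor r p q A = signof \<sigma> * minor r p' q A"
    using det_permute_rows[of ?M r \<sigma>] assms(1) by (simp add: minor_def atLeast0LessThan)
qed

lemma minor_permute_columns:
  fixes p q q' :: "nat \<Rightarrow> 'n::{finite,linorder}"
  assumes "\<sigma> permutes {..<r}" and "\<And>b. b < r \<Longrightarrow> q b = q' (\<sigma> b)"
  shows "minor r p q = (\<lambda>A. signof \<sigma> * minor r p q' A)"
  using minor_permute_rows[of \<sigma> r q q' p] assms minor_transpose[of r p q] minor_transpose[of r p q']
  by auto

lemma inj_on_strict_mono_permutation:
  fixes p :: "nat \<Rightarrow> 'a::linorder"
  assumes inj: "inj_on p {..<r}"
  obtains p' \<sigma> where "strict_mono_on {..<r} p'" "\<sigma> permutes {..<r}" "\<And>a. a < r \<Longrightarrow> p a = p' (\<sigma> a)"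
proof
  let ?S = "p ` {..<r}"
  let ?xs = "sorted_list_of_set ?S"
  let ?p' = "(!) ?xs"
  let ?\<sigma> = "\<lambda>a. if a < r then inv_into {..<r} ?p' (p a) else a"
  have len: "length ?xs = r" using inj by (simp add: card_image)
  show mono: "strict_mono_on {..<r} ?p'"
    using sorted_wrt_nth_less[OF strict_sorted_list_of_set[of ?S]] len
    by (auto simp: strict_mono_on_def)
  have bij: "bij_betw ?p' {..<r} ?S"
    using len by (intro bij_betw_nth) auto
  show "p a = ?p' (?\<sigma> a)" if "a < r" for a
    using that bij_betw_inv_into_right[OF bij, of "p a"] by simp
  have "bij_betw (inv_into {..<r} ?p' \<circ> p) {..<r} {..<r}"
    using bij_betw_trans[OF inj_on_imp_bij_betw[OF inj] bij_betw_inv_into[OF bij]] .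
  then have "bij_betw ?\<sigma> {..<r} {..<r}"
    by (rule bij_betw_cong[THEN iffD1, rotated]) auto
  then show "?\<sigma> permutes {..<r}"
    by (rule bij_imp_permutes) auto
qed

text \<open>A selection with a repeated index gives a vanishing determinant; any other one is a
  rearrangement of an increasing selection, which changes the determinant by a sign only.\<close>

lemma minor_in_minor_ideal: "minor r p q \<in> minor_ideal r"
proof (cases "inj_on p {..<r} \<and> inj_on q {..<r}")
  case True
  obtain p' \<sigma> where p': "strict_mono_on {..<r} p'" "\<sigma> permutes {..<r}" "\<And>a. a < r \<Longrightarrow> p a = p' (\<sigma> a)"
    using inj_on_strict_mono_permutation[of p r] True by blast
  obtain q' \<tau> where q': "strict_mono_on {..<r} q'" "\<tau> permutes {..<r}" "\<And>b. b < r \<Longrightarrow> q b = q' (\<tau> b)"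
    using inj_on_strict_mono_permutation[of q r] True by blast
  have "minor r p' q' \<in> minor_ideal r"
    using minors_in_minor_ideal p'(1) q'(1) by (auto simp: minors_def)
  then have "(\<lambda>A. signof \<sigma> * (signof \<tau> * minor r p' q' A)) \<in> minor_ideal r"
    by (intro minor_ideal_mult polyfun.const)
  then show ?thesis
    using minor_permute_rows[of \<sigma> r p p' q] p' minor_permute_columns[of \<tau> r q q' p'] q' by simp
next
  case False
  then have "minor r p q = (\<lambda>A. 0)"
    using minor_not_inj_rows[of p r q] minor_not_inj_columns[of q r p] by blast
  then show ?thesis by (simp add: minor_ideal_zero)
qed

text \<open>Cofactors along a row do not see that row, so expanding along it with the entries of
  row \<open>i\<close> of the big matrix computes the minor whose row \<open>a\<close> is replaced by row \<open>i\<close>.\<close>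

lemma minor_replace_row:
  assumes "a < r"
  shows "(\<Sum>b<r. A $ i $ q b * cofactor (Matrix.mat r r (\<lambda>(a, b). A $ p a $ q b)) a b)
    = minor r (p(a := i)) q A"
proof -
  let ?M = "Matrix.mat r r (\<lambda>(a, b). A $ p a $ q b)"
  let ?N = "Matrix.mat r r (\<lambda>(c, b). A $ (p(a := i)) c $ q b)"
  have "mat_delete ?M a b = mat_delete ?N a b" for b
    by (rule eq_matI) (auto simp: mat_delete_def)
  then have "cofactor ?M a b = cofactor ?N a b" for b
    by (simp add: cofactor_def)
  then show ?thesis
    using laplace_expansion_row[of ?N r a] assms by (simp add: minor_def)
qed

lemma minor_replace_column:
  assumes "b < r"
  shows "(\<Sum>a<r. A $ p a $ j * cofactor (Matrix.mat r r (\<lambda>(a, b). A $ p a $ q b)) a b)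
    = minor r p (q(b := j)) A"
proof -
  let ?M = "Matrix.mat r r (\<lambda>(a, b). A $ p a $ q b)"
  let ?N = "Matrix.mat r r (\<lambda>(a, c). A $ p a $ (q(b := j)) c)"
  have "mat_delete ?M a b = mat_delete ?N a b" for a
    by (rule eq_matI) (auto simp: mat_delete_def)
  then have "cofactor ?M a b = cofactor ?N a b" for a
    by (simp add: cofactor_def)
  then show ?thesis
    using laplace_expansion_column[of ?N r b] assms by (simp add: minor_def)
qed

section \<open>The bracket with a coordinate function\<close>

context standard_poisson_bracket
begin

lemma bracket_const:
  assumes "h \<in> polyfun"
  shows "B (\<lambda>A. c) h = (\<lambda>A. 0)"
proof -
  have "B (\<lambda>A. 1) h = (\<lambda>A. 0)"
    using leibniz_left[OF polyfun.const[of 1] polyfun.const[of 1] assms] by (auto simp: fun_eq_iff)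
  then show ?thesis using scale_left[OF polyfun.const[of 1] assms, of c] by simp
qed

lemma bracket_sum:
  assumes "finite S" and "\<And>x. x \<in> S \<Longrightarrow> f x \<in> polyfun" and h: "h \<in> polyfun"
  shows "B (\<lambda>A. \<Sum>x\<in>S. f x A) h = (\<lambda>A. \<Sum>x\<in>S. B (f x) h A)"
  using assms(1,2)
  by (induction S rule: finite_induct) (simp_all add: bracket_const h add_left polyfun_sum)

lemma bracket_prod:
  assumes "finite S" and "\<And>x. x \<in> S \<Longrightarrow> f x \<in> polyfun" and h: "h \<in> polyfun"
  shows "B (\<lambda>A. \<Prod>x\<in>S. f x A) h = (\<lambda>A. \<Sum>k\<in>S. B (f k) h A * (\<Prod>x\<in>S - {k}. f x A))"
  using assms(1,2)
proof (induction S rule: finite_induct)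
  case empty
  then show ?case by (simp add: bracket_const h)
next
  case (insert y S)
  have "B (\<lambda>A. f y A * (\<Prod>x\<in>S. f x A)) h A
      = B (f y) h A * (\<Prod>x\<in>S. f x A)
        + (\<Sum>k\<in>S. B (f k) h A * (f y A * (\<Prod>x\<in>S - {k}. f x A)))" for A
    using insert by (simp add: leibniz_left polyfun_prod h sum_distrib_left algebra_simps)
  moreover have "f y A * (\<Prod>x\<in>S - {k}. f x A) = (\<Prod>x\<in>insert y S - {k}. f x A)" if "k \<in> S" for k A
  proof -
    have "insert y S - {k} = insert y (S - {k})" using insert that by auto
    then show ?thesis using insert by simp
  qed
  moreover have "insert y S - {y} = S" using insert by auto
  ultimately show ?case using insert by (simp add: fun_eq_iff)
qed

text \<open>Grouping the terms of the Leibniz expansion by the differentiated factor, the terms for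
  row \<open>k\<close> form the determinant with row \<open>k\<close> differentiated, which Laplace expansion
  rewrites in terms of cofactors.\<close>

lemma bracket_det:
  assumes F: "\<And>a b. F a b \<in> polyfun" and h: "h \<in> polyfun"
  shows "B (\<lambda>A. Determinant.det (Matrix.mat r r (\<lambda>(a, b). F a b A))) h
    = (\<lambda>A. \<Sum>k<r. \<Sum>b<r. B (F k b) h A * cofactor (Matrix.mat r r (\<lambda>(a, b). F a b A)) k b)"
proof
  fix A :: "'n cmat"
  let ?P = "{\<pi>. \<pi> permutes {0..<r}}"
  let ?M = "Matrix.mat r r (\<lambda>(a, b). F a b A)"
  let ?N = "\<lambda>k. Matrix.mat r r (\<lambda>(a, b). if a = k then B (F k b) h A else F a b A)"
  have det: "Determinant.det (Matrix.mat r r (\<lambda>(a, b). G a b))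
      = (\<Sum>\<pi>\<in>?P. signof \<pi> * (\<Prod>i = 0..<r. G i (\<pi> i)))" for G :: "nat \<Rightarrow> nat \<Rightarrow> complex"
    by (auto simp: Determinant.det_def permutes_in_image intro!: sum.cong prod.cong)
  have row: "(\<Prod>i = 0..<r. if i = k then B (F k (\<pi> i)) h A else F i (\<pi> i) A)
      = B (F k (\<pi> k)) h A * (\<Prod>i\<in>{0..<r} - {k}. F i (\<pi> i) A)" if "k < r" for k \<pi>
    using that by (subst prod.remove[of _ k]) (auto intro!: prod.cong)
  have "B (\<lambda>A. Determinant.det (Matrix.mat r r (\<lambda>(a, b). F a b A))) h A
      = (\<Sum>\<pi>\<in>?P. signof \<pi> * (\<Sum>k = 0..<r. B (F k (\<pi> k)) h A * (\<Prod>i\<in>{0..<r} - {k}. F i (\<pi> i) A)))"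
    unfolding det
    by (simp add: bracket_sum bracket_prod scale_left finite_permutations polyfun_prod
        polyfun.mult polyfun.const F h)
  also have "\<dots> = (\<Sum>k<r. \<Sum>\<pi>\<in>?P. signof \<pi> * (\<Prod>i = 0..<r. if i = k then B (F k (\<pi> i)) h A else F i (\<pi> i) A))"
    unfolding sum_distrib_left
    by (subst sum.swap) (auto simp: row atLeast0LessThan[symmetric] intro!: sum.cong)
  also have "\<dots> = (\<Sum>k<r. Determinant.det (?N k))"
    by (simp add: det)
  also have "\<dots> = (\<Sum>k<r. \<Sum>b<r. B (F k b) h A * cofactor ?M k b)"
  proof (intro sum.cong refl)
    fix k assume k: "k \<in> {..<r}"
    have "mat_delete (?N k) k b = mat_delete ?M k b" for b
      by (rule eq_matI) (auto simp: mat_delete_def)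
    then have "cofactor (?N k) k b = cofactor ?M k b" for b
      by (simp add: cofactor_def)
    then show "Determinant.det (?N k) = (\<Sum>b<r. B (F k b) h A * cofactor ?M k b)"
      using laplace_expansion_row[of "?N k" r k] k by simp
  qed
  finally show "B (\<lambda>A. Determinant.det (Matrix.mat r r (\<lambda>(a, b). F a b A))) h A
    = (\<Sum>k<r. \<Sum>b<r. B (F k b) h A * cofactor ?M k b)" .
qed

lemma bracket_Z_Z: "B (Z s t) (Z i j) = (\<lambda>A. (sg s i + sg t j) * (A $ s $ j * A $ i $ t))"
  using standard_poisson_bracket_unique[OF standard_poisson_bracket_axioms std_bracket_standard
      polyfun_Z polyfun_Z] std_bracket_Z by metis

text \<open>In the bracket of an entry with \<open>Z i j\<close>, the coefficient \<open>sg s i + sg t j\<close> splits into a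
  part seeing only the row and a part seeing only the column of the entry. Summed against the
  cofactors, the first part replaces a row of the minor by row \<open>i\<close>, the second replaces a
  column by column \<open>j\<close>.\<close>

lemma bracket_minor_Z:
  "B (minor r p q) (Z i j) = (\<lambda>A.
      (\<Sum>a<r. sg (p a) i * A $ p a $ j * minor r (p(a := i)) q A)
    + (\<Sum>b<r. sg (q b) j * A $ i $ q b * minor r p (q(b := j)) A))"
proof
  fix A :: "'n cmat"
  let ?C = "cofactor (Matrix.mat r r (\<lambda>(a, b). A $ p a $ q b))"
  have minor_Z: "minor r p q = (\<lambda>A. Determinant.det (Matrix.mat r r (\<lambda>(a, b). Z (p a) (q b) A)))"
    by (simp add: minor_def Z_def)
  have "B (minor r p q) (Z i j) A = (\<Sum>a<r. \<Sum>b<r. B (Z (p a) (q b)) (Z i j) A * ?C a b)"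
    using bracket_det[of "\<lambda>a b. Z (p a) (q b)" "Z i j" r, OF polyfun_Z polyfun_Z]
    unfolding minor_Z by (simp add: Z_def)
  also have "\<dots> = (\<Sum>a<r. \<Sum>b<r. sg (p a) i * A $ p a $ j * (A $ i $ q b * ?C a b))
      + (\<Sum>a<r. \<Sum>b<r. sg (q b) j * A $ i $ q b * (A $ p a $ j * ?C a b))"
    by (simp add: bracket_Z_Z sum.distrib[symmetric] algebra_simps)
  also have "(\<Sum>a<r. \<Sum>b<r. sg (q b) j * A $ i $ q b * (A $ p a $ j * ?C a b))
      = (\<Sum>b<r. \<Sum>a<r. sg (q b) j * A $ i $ q b * (A $ p a $ j * ?C a b))"
    by (rule sum.swap)
  finally show "B (minor r p q) (Z i j) A
      = (\<Sum>a<r. sg (p a) i * A $ p a $ j * minor r (p(a := i)) q A)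
      + (\<Sum>b<r. sg (q b) j * A $ i $ q b * minor r p (q(b := j)) A)"
    by (simp add: sum_distrib_left[symmetric] minor_replace_row minor_replace_column)
qed

lemma bracket_minor_Z_in_minor_ideal: "B (minor r p q) (Z i j) \<in> minor_ideal r"
  unfolding bracket_minor_Z
  by (intro minor_ideal_add minor_ideal_sum minor_ideal_mult minor_in_minor_ideal
      polyfun.intros finite_lessThan)

section \<open>Invariance of the ideal\<close>

text \<open>By the Leibniz rule, the elements of an ideal that a derivation maps back into the ideal
  form an ideal; so it is enough to look at generators.\<close>

lemma bracket_Z_in_minor_ideal:
  assumes "g \<in> minor_ideal r"
  shows "B g (Z i j) \<in> minor_ideal r"
proof -
  let ?J = "{g \<in> minor_ideal r. B g (Z i j) \<in> minor_ideal r}"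
  have "ideal ?J polyfun_ring"
  proof (rule ideal_polyfun_ringI)
    fix f g :: "'n cmat \<Rightarrow> complex"
    assume f: "f \<in> polyfun" and g: "g \<in> ?J"
    have "(\<lambda>A. f A * B g (Z i j) A + B f (Z i j) A * g A) \<in> minor_ideal r"
      using f g by (intro minor_ideal_add minor_ideal_mult closed polyfun_Z) auto
    then show "(\<lambda>A. f A * g A) \<in> ?J"
      using f g minor_ideal_polyfun[of g r] by (simp add: leibniz_left polyfun_Z minor_ideal_mult)
  next
    fix f g assume fg: "f \<in> ?J" "g \<in> ?J"
    then show "(\<lambda>A. f A + g A) \<in> ?J"
      using minor_ideal_polyfun[of f r] minor_ideal_polyfun[of g r]
      by (simp add: add_left polyfun_Z minor_ideal_add)
  qed (auto simp: bracket_const polyfun_Z minor_ideal_zero intro: minor_ideal_polyfun)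
  moreover have "minors r \<subseteq> ?J"
    using minors_in_minor_ideal bracket_minor_Z_in_minor_ideal by (auto simp: minors_def)
  ultimately have "minor_ideal r \<subseteq> ?J"
    unfolding minor_ideal_def genideal_def by blast
  then show ?thesis using assms by blast
qed

lemma minor_ideal_invariant:
  assumes "f \<in> polyfun" and g: "g \<in> minor_ideal r"
  shows "B f g \<in> minor_ideal r"
  using assms(1)
proof induction
  case (const c)
  then show ?case by (simp add: bracket_const minor_ideal_polyfun[OF g] minor_ideal_zero)
next
  case (coord i j)
  have "B (Z i j) g = (\<lambda>A. - 1 * B g (Z i j) A)"
    using antisym[OF polyfun_Z minor_ideal_polyfun[OF g]] by simp
  also have "\<dots> \<in> minor_ideal r"
    by (intro minor_ideal_mult polyfun.const bracket_Z_in_minor_ideal g)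
  finally show ?case by (simp add: Z_def)
next
  case (add f1 f2)
  then show ?case by (simp add: add_left minor_ideal_polyfun[OF g] minor_ideal_add)
next
  case (mult f1 f2)
  then have "(\<lambda>A. f1 A * B f2 g A + f2 A * B f1 g A) \<in> minor_ideal r"
    by (intro minor_ideal_add minor_ideal_mult)
  then show ?case
    using mult by (simp add: leibniz_left minor_ideal_polyfun[OF g] mult.commute)
qed

end

theorem proposition12p5:
  fixes B :: "('n::{finite,linorder} cmat \<Rightarrow> complex) \<Rightarrow> ('n cmat \<Rightarrow> complex)
      \<Rightarrow> 'n cmat \<Rightarrow> complex"
    and r :: nat
  assumes "standard_poisson_bracket B"
    and "1 \<le> r" and "r \<le> CARD('n)"
    and "f \<in> carrier polyfun_ring" and "g \<in> minor_ideal r"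
  shows "B f g \<in> minor_ideal r"
  using standard_poisson_bracket.minor_ideal_invariant[OF assms(1)] assms(4,5) by simp

end
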